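(* For all integers $n\ge m\ge 2$, $$pw(K_m\,\square\, K_n)=\begin{cases}\frac{m}{2}n+\frac{m}{2}-1 & \text{if } m \text{ is even},\\ \lceil \frac{m}{2}\rceil n-1 & \text{if } m \text{ is odd}.\end{cases}$$
   Context: $K_m$ is the complete graph on $m$ vertices, and $G\,\square\, H$ is the Cartesian product of graphs: vertex set $V(G)\times V(H)$, with $(g,h)$ adjacent to $(g',h')$ iff ($g=g'$ and $hh'\in E(H)$) or ($h=h'$ and $gg'\in E(G)$). A path decomposition of a graph $G$ is a sequence $(B_1,\dots,B_r)$ of subsets of $V(G)$ (bags) such that (i) $\bigcup_{1\le i\le r}B_i=V(G)$; (ii) for every edge $vw\in E(G)$ there is $i\in\{1,\dots,r\}$ with $v,w\in B_i$; (iii) for all $i\le j\le k$ in $\{1,\dots,r\}$, $B_i\cap B_k\subseteq B_j$. Its width is $\max_{1\le i\le r}|B_i|-1$. The pathwidth $pw(G)$ is the minimum width over all path decompositions of $G$. *)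

theory Defs
  imports Complex_Main "Graph_Theory.Graph_Theory"
begin

text \<open>
  Simple graphs are the symmetric digraphs of the locale \<^locale>\<open>graph\<close>; an undirected edge
  is the pair of opposite arcs, and adjacency is \<^const>\<open>dominates\<close>. \<open>K\<^bsub>n\<^esub> G\<close> (that is,
  \<^const>\<open>complete_digraph\<close>) says that \<open>G\<close> is a complete graph on \<open>n\<close> vertices.
\<close>

definition cartesian_product ::
  "('a, 'c) pre_digraph \<Rightarrow> ('b, 'd) pre_digraph \<Rightarrow> ('a \<times> 'b) pair_pre_digraph"  (infixr \<open>\<box>\<close> 80)
  where
  "G \<box> H = \<lparr> pverts = verts G \<times> verts H,
     parcs = {((g, h), (g', h')) | g h g' h'.
       (g, h) \<in> verts G \<times> verts H \<and> (g', h') \<in> verts G \<times> verts H \<and>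
       (g = g' \<and> h \<rightarrow>\<^bsub>H\<^esub> h' \<or> h = h' \<and> g \<rightarrow>\<^bsub>G\<^esub> g')} \<rparr>"

text \<open>
  Bags are indexed from 0. The list is required to be nonempty so that the width is defined; this
  excludes something only for the graph without vertices.
\<close>

definition path_decomposition :: "('a, 'b) pre_digraph \<Rightarrow> 'a set list \<Rightarrow> bool" where
  "path_decomposition G Bs \<longleftrightarrow>
     Bs \<noteq> [] \<and>
     (\<Union>i<length Bs. Bs ! i) = verts G \<and>
     (\<forall>v w. v \<rightarrow>\<^bsub>G\<^esub> w \<longrightarrow> (\<exists>i<length Bs. v \<in> Bs ! i \<and> w \<in> Bs ! i)) \<and>
     (\<forall>i j k. i \<le> j \<and> j \<le> k \<and> k < length Bs \<longrightarrow> Bs ! i \<inter> Bs ! k \<subseteq> Bs ! j)"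

text \<open>
  Widths are integers because the only decompositions of the graph without vertices have width -1.
\<close>

definition decomposition_width :: "'a set list \<Rightarrow> int" where
  "decomposition_width Bs = int (MAX i\<in>{..<length Bs}. card (Bs ! i)) - 1"

definition pathwidth :: "('a, 'b) pre_digraph \<Rightarrow> int" where
  "pathwidth G = (LEAST w. \<exists>Bs. path_decomposition G Bs \<and> w = decomposition_width Bs)"

lemma pair_graph_cartesian_product:
  assumes "graph G" "graph H"
  shows "pair_graph (G \<box> H)"
proof -
  interpret G: graph G by fact
  interpret H: graph H by fact
  have fin: "finite (verts G \<times> verts H)"
    by simp
  have "parcs (G \<box> H) \<subseteq> (verts G \<times> verts H) \<times> (verts G \<times> verts H)"
    by (auto simp: cartesian_product_def)
  then have fin': "finite (parcs (G \<box> H))"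
    by (rule finite_subset) (use fin in blast)
  have loopG: "\<not> g \<rightarrow>\<^bsub>G\<^esub> g" for g
    using G.no_loops by (auto simp: arcs_ends_conv)
  have loopH: "\<not> h \<rightarrow>\<^bsub>H\<^esub> h" for h
    using H.no_loops by (auto simp: arcs_ends_conv)
  have "sym (parcs (G \<box> H))"
    using arcs_ends_symmetric[OF G.sym_arcs] arcs_ends_symmetric[OF H.sym_arcs]
    by (intro symI) (auto simp: cartesian_product_def)
  then show ?thesis
    using fin fin' loopG loopH
    by unfold_locales (auto simp: symmetric_def cartesian_product_def)
qed

lemma path_decomposition_trivial:
  assumes "wf_digraph G"
  shows "path_decomposition G [verts G]"
proof -
  interpret wf_digraph G by fact
  show ?thesis
    by (auto simp: path_decomposition_def arcs_ends_conv)
qed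

lemma decomposition_width_ge: "decomposition_width Bs \<ge> - 1"
  by (simp add: decomposition_width_def)

text \<open>The least width is attained.\<close>

lemma
  assumes "wf_digraph G"
  shows pathwidth_attained: "\<exists>Bs. path_decomposition G Bs \<and> decomposition_width Bs = pathwidth G"
    and pathwidth_le: "path_decomposition G Bs \<Longrightarrow> pathwidth G \<le> decomposition_width Bs"
proof -
  define f where "f Bs = nat (decomposition_width Bs + 1)" for Bs :: "'a set list"
  obtain Bs0 where Bs0: "path_decomposition G Bs0"
    and min: "\<And>Bs. path_decomposition G Bs \<Longrightarrow> f Bs0 \<le> f Bs"
    using ex_has_least_nat[of "path_decomposition G" _ f] path_decomposition_trivial[OF assms]
    by metis
  have le: "decomposition_width Bs0 \<le> decomposition_width Bs" if "path_decomposition G Bs" for Bs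
    using min[OF that] decomposition_width_ge[of Bs0] decomposition_width_ge[of Bs]
    by (simp add: f_def)
  have eq: "pathwidth G = decomposition_width Bs0"
    unfolding pathwidth_def by (rule Least_equality) (use Bs0 le in auto)
  show "\<exists>Bs. path_decomposition G Bs \<and> decomposition_width Bs = pathwidth G"
    using Bs0 eq by auto
  show "path_decomposition G Bs \<Longrightarrow> pathwidth G \<le> decomposition_width Bs"
    using le eq by simp
qed

end

theory Submission
  imports Defs
begin

text \<open>
  Both bounds come from a translation into lattice paths. Write \<open>P \<times> Q\<close> for the vertex set, with
  \<open>card P = m\<close> and \<open>card Q = n\<close>. In a path decomposition, a vertex that has left the bags for good
  and a vertex that has not yet appeared share neither a row nor a column. So if the vertices that
  are gone when bag number \<open>i\<close> starts meet \<open>r i\<close> rows and \<open>c i\<close> columns, then at most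
  \<open>r i * c i\<close> vertices precede bag \<open>i\<close> and at most \<open>(m - r (i + 1)) * (n - c (i + 1))\<close> follow it;
  the bag contains all others. The points \<open>(r i, c i)\<close> climb from \<open>(0, 0)\<close> to \<open>(m, n)\<close>, and the
  bound on the bag depends only on the step from one point to the next
  (\<open>staircase_of_path_decomposition\<close>). Conversely, every climbing sequence of points yields a path
  decomposition whose bags are exactly as large as these bounds
  (\<open>path_decomposition_of_staircase\<close>). Hence the pathwidth plus one is the least possible
  maximal step cost of a staircase, a question about numbers only.

  If \<open>m = 2 * k + 1\<close>, the step that passes from at most \<open>k\<close> to more than \<open>k\<close> rows costs at least
  \<open>(k + 1) * n\<close>. If \<open>m = 2 * k\<close>, a step on or across the level \<open>r = k\<close> that gains a column costs
  at least \<open>k * n + k\<close>; when no such step exists, the staircase reaches and leaves this level in the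
  same column \<open>c\<close>, at costs of at least \<open>k * n + c\<close> and \<open>k * n + (n - c)\<close>, and one of \<open>c\<close>, \<open>n - c\<close>
  is at least \<open>k\<close>. The staircase through \<open>(\<lfloor>m/2\<rfloor>, 0)\<close>, \<open>(\<lfloor>m/2\<rfloor>, \<lfloor>m/2\<rfloor>)\<close>, \<open>(\<lceil>m/2\<rceil>, \<lfloor>m/2\<rfloor>)\<close>, \<open>(\<lceil>m/2\<rceil>, n)\<close> attains
  these values.
\<close>

section \<open>Staircases and their step costs\<close>

text \<open>
  Steps may be diagonal or longer than one unit, since between two bags of a path decomposition
  many rows and columns can be completed at once.
\<close>

definition staircase :: "nat \<Rightarrow> nat \<Rightarrow> nat \<Rightarrow> (nat \<Rightarrow> nat) \<Rightarrow> (nat \<Rightarrow> nat) \<Rightarrow> bool" where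
  "staircase m n L r c \<longleftrightarrow>
     mono r \<and> mono c \<and> r 0 = 0 \<and> c 0 = 0 \<and> r L = m \<and> c L = n"

text \<open>
  The number of cells of an \<open>m\<close> by \<open>n\<close> board outside the lower left \<open>r i\<close> by \<open>c i\<close> corner and
  outside the upper right corner that starts at the next point.
\<close>

definition step_cost :: "nat \<Rightarrow> nat \<Rightarrow> (nat \<Rightarrow> nat) \<Rightarrow> (nat \<Rightarrow> nat) \<Rightarrow> nat \<Rightarrow> int" where
  "step_cost m n r c i =
     int m * int n - int (r i) * int (c i)
       - (int m - int (r (Suc i))) * (int n - int (c (Suc i)))"

lemma staircase_le:
  assumes "staircase m n L r c" "i \<le> L"
  shows "r i \<le> m" "c i \<le> n"
  using assms monoD[of r i L] monoD[of c i L] by (simp_all add: staircase_def)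

text \<open>
  The cost can only grow when a step is prolonged in the rows, backwards or forwards. So for a step
  that passes a level, its unknown row numbers may be replaced by ones at or next to that level.
\<close>

lemma step_cost_ge:
  assumes st: "staircase m n L r c" and "i < L"
    and p: "int (r i) \<le> p" and q: "q \<le> int (r (Suc i))"
  shows "int m * int n - p * int (c i) - (int m - q) * (int n - int (c (Suc i)))
    \<le> step_cost m n r c i"
proof -
  have "c (Suc i) \<le> n"
    using staircase_le[OF st, of "Suc i"] \<open>i < L\<close> by simp
  then have "(int m - int (r (Suc i))) * (int n - int (c (Suc i)))
      \<le> (int m - q) * (int n - int (c (Suc i)))"
    using q by (intro mult_right_mono) auto
  moreover have "int (r i) * int (c i) \<le> p * int (c i)"
    using p by (intro mult_right_mono) auto
  ultimately show ?thesis
    by (simp add: step_cost_def)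
qed

lemma staircase_crosses:
  assumes st: "staircase m n L r c" and "k < m"
  obtains i where "i < L" "r i \<le> k" "k < r (Suc i)" "\<And>j. j \<le> i \<Longrightarrow> r j \<le> k"
proof -
  define j where "j = (LEAST j. k < r j)"
  have "k < r L"
    using assms by (simp add: staircase_def)
  then have j: "k < r j" "j \<le> L"
    unfolding j_def by (auto intro: LeastI Least_le)
  have below: "r i \<le> k" if "i < j" for i
    using not_less_Least[of i "\<lambda>j. k < r j"] that by (auto simp: j_def)
  obtain i where "j = Suc i"
    using j(1) st by (cases j) (auto simp: staircase_def)
  then show ?thesis
    using that[of i] j below by auto
qed

lemma odd_staircase_costly_step:
  assumes st: "staircase m n L r c" and m: "m = 2 * k + 1"
  shows "\<exists>i<L. int (Suc k * n) \<le> step_cost m n r c i"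
proof -
  obtain i where i: "i < L" "r i \<le> k" "k < r (Suc i)"
    using staircase_crosses[OF st, of k] m by auto
  have "c i \<le> c (Suc i)"
    using st by (simp add: staircase_def mono_iff_le_Suc)
  then have "int k * int (c i) \<le> int k * int (c (Suc i))"
    by (intro mult_left_mono) auto
  then have "int (Suc k * n) \<le> int m * int n - int k * int (c i)
      - (int m - int (Suc k)) * (int n - int (c (Suc i)))"
    by (simp add: m algebra_simps)
  also have "\<dots> \<le> step_cost m n r c i"
    using i by (intro step_cost_ge[OF st]) auto
  finally show ?thesis
    using i by blast
qed

lemma even_staircase_costly_step:
  assumes st: "staircase m n L r c" and m: "m = 2 * k" and k: "0 < k" "2 * k \<le> n"
  shows "\<exists>i<L. int (k * n + k) \<le> step_cost m n r c i"
proof (rule ccontr)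
  assume "\<not> ?thesis"
  then have cheap: "step_cost m n r c i < int (k * n + k)" if "i < L" for i
    using that by auto
  have mono: "mono r" "mono c"
    using st by (auto simp: staircase_def)
  \<comment> \<open>The staircase reaches level \<open>k\<close> in step \<open>a\<close> and leaves it in step \<open>b\<close>, possibly \<open>a = b\<close>.\<close>
  obtain a where a: "a < L" "r a \<le> k - 1" "k - 1 < r (Suc a)"
    by (rule staircase_crosses[OF st, of "k - 1"]) (use m k in simp, blast)
  obtain b where b: "b < L" "r b \<le> k" "k < r (Suc b)" and b_min: "\<And>j. j \<le> b \<Longrightarrow> r j \<le> k"
    by (rule staircase_crosses[OF st, of k]) (use m k in simp, blast)
  have "a \<le> b"
  proof (rule ccontr)
    assume "\<not> a \<le> b"
    then have "r (Suc b) \<le> r a"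
      using monoD[OF mono(1), of "Suc b" a] by simp
    then show False
      using a b k by simp
  qed
  \<comment> \<open>From \<open>a\<close> to \<open>b\<close> every step has \<open>r i \<le> k \<le> r (i + 1)\<close>, so gaining a column would cost \<open>k\<close> more.\<close>
  have flat: "c (Suc i) = c i" if "a \<le> i" "i \<le> b" for i
  proof (rule ccontr)
    assume "c (Suc i) \<noteq> c i"
    moreover have "c i \<le> c (Suc i)"
      using mono by (simp add: mono_iff_le_Suc)
    ultimately have "int k * (int (c i) + 1) \<le> int k * int (c (Suc i))"
      by (intro mult_left_mono) auto
    then have "int (k * n + k) \<le> int m * int n - int k * int (c i)
        - (int m - int k) * (int n - int (c (Suc i)))"
      by (simp add: m algebra_simps)
    also have "\<dots> \<le> step_cost m n r c i"
    proof (rule step_cost_ge[OF st])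
      have "r (Suc a) \<le> r (Suc i)"
        using monoD[OF mono(1), of "Suc a" "Suc i"] that by simp
      then show "int k \<le> int (r (Suc i))"
        using a by simp
    qed (use that b b_min in auto)
    finally show False
      using cheap[of i] that b by simp
  qed
  have same: "c j = c a" if "a \<le> j" "j \<le> Suc b" for j
    using that
  proof (induction j rule: dec_induct)
    case (step j)
    then show ?case
      using flat[of j] by simp
  qed simp
  have ca: "c (Suc a) = c a" "c b = c a" "c (Suc b) = c a"
    using same[of "Suc a"] same[of b] same[of "Suc b"] \<open>a \<le> b\<close> by simp_all
  have "int k * int n + int (c a)
      = int m * int n - (int k - 1) * int (c a) - (int m - int k) * (int n - int (c (Suc a)))"
    by (simp add: m ca algebra_simps)
  also have "\<dots> \<le> step_cost m n r c a"
    using a k by (intro step_cost_ge[OF st]) auto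
  finally have "c a < k"
    using cheap[OF a(1)] by simp
  have "int k * int n + (int n - int (c a))
      = int m * int n - int k * int (c b) - (int m - (int k + 1)) * (int n - int (c (Suc b)))"
    by (simp add: m ca algebra_simps)
  also have "\<dots> \<le> step_cost m n r c b"
    using b by (intro step_cost_ge[OF st]) auto
  finally have "n < c a + k"
    using cheap[OF b(1)] by simp
  then show False
    using \<open>c a < k\<close> k by simp
qed

text \<open>
  For odd \<open>m\<close> the columns must be split: on level \<open>\<lfloor>m/2\<rfloor>\<close> the steps become more expensive as \<open>c\<close>
  grows and on level \<open>\<lceil>m/2\<rceil>\<close> they become cheaper, so the level is changed at a column where both
  are affordable. For even \<open>m\<close> the two levels coincide and this change is an idle step.
\<close>

lemma cheap_staircase:
  assumes "m \<le> n" and k: "k = m div 2" and l: "l = m - k"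
  shows "\<exists>L r c. staircase m n L r c \<and>
    (\<forall>i<L. step_cost m n r c i \<le> int (l * n + (if even m then k else 0)))"
proof -
  \<comment> \<open>The shift from \<open>i - 1\<close> to \<open>i - 2\<close> in the columns makes step \<open>k + 1\<close>, the change of level, vertical.\<close>
  define r where "r i = (if i = 0 then 0 else if i \<le> k + 1 then k else if i \<le> n + 2 then l else m)"
    for i :: nat
  define c where "c i = (if i \<le> k + 1 then i - 1 else min n (i - 2))" for i :: nat
  have kl: "k \<le> l" "l \<le> k + 1" "k + l = m" "l \<le> m" "k \<le> n"
    using assms by auto
  have "r i \<le> r (Suc i)" "c i \<le> c (Suc i)" for i
    using kl by (auto simp: r_def c_def)
  then have "staircase m n (n + 3) r c"
    using kl by (auto simp: staircase_def mono_iff_le_Suc r_def c_def)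
  moreover have "step_cost m n r c i \<le> int (l * n + (if even m then k else 0))" if "i < n + 3" for i
  proof -
    have parity: "(even m \<and> l = k) \<or> (odd m \<and> l = k + 1)"
      using k l by presburger
    have m: "int m = int k + int l"
      using kl by simp
    consider "i = 0" | "1 \<le> i" "i \<le> k" | "i = k + 1" | "k + 2 \<le> i" "i \<le> n + 1" | "i = n + 2"
      using \<open>i < n + 3\<close> by atomize_elim linarith
    then show ?thesis
    proof cases
      case 1
      have "step_cost m n r c i = int k * int n"
        by (simp add: 1 step_cost_def r_def c_def m algebra_simps)
      also have "\<dots> \<le> int l * int n"
        using kl by (intro mult_right_mono) auto
      finally show ?thesis
        by simp
    next
      case 2
      then obtain d where d: "i = Suc d" "d < k"
        by (cases i) auto
      have "step_cost m n r c i = int k * int n + (int l - int k) * int d + int l"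
        using d by (simp add: step_cost_def r_def c_def m algebra_simps)
      \<comment> \<open>For odd \<open>m\<close> this needs \<open>d + l \<le> n\<close>, which holds because \<open>d < k\<close> and \<open>k + l \<le> n\<close>.\<close>
      then show ?thesis
        using parity d assms(1) m by (auto simp: algebra_simps)
    next
      case 3
      have "step_cost m n r c i = int l * int n"
        using kl by (simp add: 3 step_cost_def r_def c_def m algebra_simps)
      then show ?thesis
        by simp
    next
      case 4
      define d where "d = i - 2"
      then have d: "i = d + 2" "k \<le> d" "d < n"
        using 4 by auto
      have "step_cost m n r c i = int l * int n + int k - (int l - int k) * int d"
        using d by (simp add: step_cost_def r_def c_def m algebra_simps)
      then show ?thesis
        using parity d by auto
    next
      case 5
      have "step_cost m n r c i = int k * int n"
        using kl by (simp add: 5 step_cost_def r_def c_def m algebra_simps)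
      also have "\<dots> \<le> int l * int n"
        using kl by (intro mult_right_mono) auto
      finally show ?thesis
        by simp
    qed
  qed
  ultimately show ?thesis
    by blast
qed

section \<open>Path decompositions as staircases\<close>

lemma dominates_box_complete:
  assumes "K\<^bsub>m\<^esub> G" "K\<^bsub>n\<^esub> H"
  shows "v \<rightarrow>\<^bsub>with_proj (G \<box> H)\<^esub> w \<longleftrightarrow>
    v \<in> verts G \<times> verts H \<and> w \<in> verts G \<times> verts H \<and> v \<noteq> w \<and> (fst v = fst w \<or> snd v = snd w)"
  using assms
  by (cases v; cases w) (auto simp: cartesian_product_def complete_digraph_def)

lemma complete_digraph_verts:
  assumes "K\<^bsub>n\<^esub> G"
  shows "finite (verts G)" "card (verts G) = n"
proof -
  interpret graph G
    using assms by (simp add: complete_digraph_def)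
  show "finite (verts G)" "card (verts G) = n"
    using assms by (simp_all add: complete_digraph_def)
qed

lemma verts_box: "verts (with_proj (G \<box> H)) = verts G \<times> verts H"
  by (simp add: cartesian_product_def)

lemma card_bag_le_decomposition_width:
  assumes "i < length Bs"
  shows "int (card (Bs ! i)) \<le> decomposition_width Bs + 1"
  using assms by (auto simp: decomposition_width_def intro!: Max_ge)

lemma decomposition_width_leI:
  assumes "Bs \<noteq> []" "\<And>i. i < length Bs \<Longrightarrow> int (card (Bs ! i)) \<le> w + 1"
  shows "decomposition_width Bs \<le> w"
proof -
  have "(MAX i\<in>{..<length Bs}. card (Bs ! i)) \<in> (\<lambda>i. card (Bs ! i)) ` {..<length Bs}"
    using assms(1) by (intro Max_in) auto
  then obtain i where "i < length Bs" "(MAX i\<in>{..<length Bs}. card (Bs ! i)) = card (Bs ! i)"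
    by auto
  then show ?thesis
    using assms(2)[of i] by (simp add: decomposition_width_def)
qed

text \<open>
  The rows met by the vertices gone before bag \<open>i + 1\<close> contain no vertex that appears only after bag
  \<open>i\<close>, since two vertices of a row share a bag; likewise for columns. This is why the future of bag
  \<open>i\<close> is bounded by point \<open>i + 1\<close> of the staircase, and its past by point \<open>i\<close>.
\<close>

lemma staircase_of_path_decomposition:
  fixes G :: "('a, 'c) pre_digraph" and H :: "('b, 'd) pre_digraph"
  assumes G: "K\<^bsub>m\<^esub> G" and H: "K\<^bsub>n\<^esub> H" and "0 < m" "0 < n"
    and pd: "path_decomposition (with_proj (G \<box> H)) Bs"
  shows "\<exists>r c. staircase m n (length Bs) r c \<and>
    (\<forall>i<length Bs. step_cost m n r c i \<le> int (card (Bs ! i)))"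
proof -
  define P where "P = verts G"
  define Q where "Q = verts H"
  have fin: "finite P" "finite Q" and card: "card P = m" "card Q = n"
    using complete_digraph_verts[OF G] complete_digraph_verts[OF H] by (auto simp: P_def Q_def)
  have cover: "(\<Union>i<length Bs. Bs ! i) = P \<times> Q"
    using pd unfolding path_decomposition_def verts_box P_def Q_def by blast
  have edge: "\<exists>i<length Bs. v \<in> Bs ! i \<and> w \<in> Bs ! i"
    if "v \<in> P \<times> Q" "w \<in> P \<times> Q" "fst v = fst w \<or> snd v = snd w" for v w
  proof (cases "v = w")
    case True
    then show ?thesis
      using that(1) cover by auto
  next
    case False
    then have "v \<rightarrow>\<^bsub>with_proj (G \<box> H)\<^esub> w"
      unfolding dominates_box_complete[OF G H] using that by (simp add: P_def Q_def)
    then show ?thesis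
      using pd unfolding path_decomposition_def by blast
  qed
  have between: "Bs ! i \<inter> Bs ! k \<subseteq> Bs ! j" if "i \<le> j" "j \<le> k" "k < length Bs" for i j k
    using pd that by (simp add: path_decomposition_def)
  \<comment> \<open>The vertices that occur in no bag from number \<open>i\<close> on.\<close>
  define gone where "gone i = {v \<in> P \<times> Q. \<forall>j<length Bs. v \<in> Bs ! j \<longrightarrow> j < i}" for i
  define R where "R i = fst ` gone i" for i
  define C where "C i = snd ` gone i" for i
  have sub: "R i \<subseteq> P" "C i \<subseteq> Q" for i
    by (auto simp: R_def C_def gone_def)
  have finRC: "finite (R i)" "finite (C i)" for i
    using finite_subset[OF sub(1)] finite_subset[OF sub(2)] fin by auto
  have gone_mono: "gone i \<subseteq> gone j" if "i \<le> j" for i j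
    using that by (force simp: gone_def)
  have gone_0: "gone 0 = {}"
    using cover by (fastforce simp: gone_def)
  have gone_L: "gone (length Bs) = P \<times> Q"
    by (auto simp: gone_def)
  have "P \<noteq> {}" "Q \<noteq> {}"
    using card assms(3,4) by auto
  then have "R (length Bs) = P" "C (length Bs) = Q"
    by (auto simp: R_def C_def gone_L)
  moreover have "mono (\<lambda>i. card (R i))" "mono (\<lambda>i. card (C i))"
    using gone_mono finRC by (auto intro!: monoI card_mono simp: R_def C_def)
  ultimately have "staircase m n (length Bs) (\<lambda>i. card (R i)) (\<lambda>i. card (C i))"
    by (simp add: staircase_def card) (simp add: R_def C_def gone_0)
  moreover have "step_cost m n (\<lambda>i. card (R i)) (\<lambda>i. card (C i)) i \<le> int (card (Bs ! i))"
    if "i < length Bs" for i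
  proof -
    let ?past = "R i \<times> C i" and ?future = "(P - R (Suc i)) \<times> (Q - C (Suc i))"
    have "P \<times> Q \<subseteq> Bs ! i \<union> ?past \<union> ?future"
    proof
      fix v assume v: "v \<in> P \<times> Q"
      consider "v \<in> gone i" | "v \<in> Bs ! i" | "v \<notin> gone i" "v \<notin> Bs ! i"
        by blast
      then show "v \<in> Bs ! i \<union> ?past \<union> ?future"
      proof cases
        case 1
        then have "v \<in> ?past"
          by (simp add: R_def C_def mem_Times_iff)
        then show ?thesis
          by blast
      next
        case 3
        then obtain j where j: "j < length Bs" "v \<in> Bs ! j" "i \<le> j"
          using v by (auto simp: gone_def not_less)
        \<comment> \<open>Present later but absent from bag \<open>i\<close>, the vertex \<open>v\<close> cannot have occurred before.\<close>
        have late: "i < i'" if "i' < length Bs" "v \<in> Bs ! i'" for i'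
        proof (rule ccontr)
          assume "\<not> i < i'"
          then show False
            using between[of i' i j] j 3(2) that by auto
        qed
        have "\<not> (fst v = fst u \<or> snd v = snd u)" if u: "u \<in> gone (Suc i)" for u
        proof
          assume "fst v = fst u \<or> snd v = snd u"
          then obtain i' where "i' < length Bs" "v \<in> Bs ! i'" "u \<in> Bs ! i'"
            using edge[of v u] v u by (auto simp: gone_def)
          then show False
            using late[of i'] u by (auto simp: gone_def)
        qed
        then have "v \<in> ?future"
          using v by (auto simp: R_def C_def mem_Times_iff)
        then show ?thesis
          by blast
      qed blast
    qed
    moreover have "finite (Bs ! i)"
      using cover that fin by (intro finite_subset[of "Bs ! i" "P \<times> Q"]) auto
    ultimately have "card (P \<times> Q) \<le> card (Bs ! i \<union> ?past \<union> ?future)"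
      using fin finRC by (intro card_mono) auto
    also have "\<dots> \<le> card (Bs ! i) + card ?past + card ?future"
      by (meson add_le_mono card_Un_le order_refl order_trans)
    finally have "card P * card Q \<le> card (Bs ! i) + card (R i) * card (C i)
        + (card P - card (R (Suc i))) * (card Q - card (C (Suc i)))"
      using sub finRC by (simp add: card_cartesian_product card_Diff_subset)
    then have "int (card P * card Q) \<le> int (card (Bs ! i) + card (R i) * card (C i)
        + (card P - card (R (Suc i))) * (card Q - card (C (Suc i))))"
      by (simp only: of_nat_le_iff)
    moreover have "card (R (Suc i)) \<le> card P" "card (C (Suc i)) \<le> card Q"
      using card_mono[OF fin(1) sub(1)] card_mono[OF fin(2) sub(2)] by auto
    ultimately show ?thesis
      by (simp add: step_cost_def card of_nat_diff)
  qed
  ultimately show ?thesis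
    by blast
qed

lemma card_initial_labels:
  assumes f: "bij_betw f A {..<m}" and "k \<le> m"
  shows "card {x \<in> A. f x < k} = k"
proof -
  have "f ` {x \<in> A. f x < k} = f ` A \<inter> {..<k}"
    by auto
  also have "\<dots> = {..<k}"
    using assms by (auto simp: bij_betw_def)
  finally have "f ` {x \<in> A. f x < k} = {..<k}" .
  then have "bij_betw f {x \<in> A. f x < k} {..<k}"
    using f by (intro bij_betw_subset[OF f]) auto
  then show ?thesis
    by (simp add: bij_betw_same_card)
qed

text \<open>
  Number the rows and columns. Of two vertices of a row or column, let \<open>w\<close> be the later one. Both lie
  in the last bag that contains the earlier vertex \<open>v\<close>: since \<open>v\<close> lies in the lower left corner of
  the next point and \<open>w\<close> shares a row or column with it, \<open>w\<close> is not in the upper right corner there,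
  and \<open>w\<close> leaves no earlier than \<open>v\<close>.
\<close>

lemma path_decomposition_of_staircase:
  fixes G :: "('a, 'c) pre_digraph" and H :: "('b, 'd) pre_digraph"
  assumes G: "K\<^bsub>m\<^esub> G" and H: "K\<^bsub>n\<^esub> H" and "0 < m"
    and st: "staircase m n L r c"
  shows "\<exists>Bs. path_decomposition (with_proj (G \<box> H)) Bs \<and> length Bs = L \<and>
    (\<forall>i<L. int (card (Bs ! i)) = step_cost m n r c i)"
proof -
  define P where "P = verts G"
  define Q where "Q = verts H"
  have fin: "finite P" "finite Q" and card: "card P = m" "card Q = n"
    using complete_digraph_verts[OF G] complete_digraph_verts[OF H] by (auto simp: P_def Q_def)
  obtain f where f: "bij_betw f P {..<m}"
    using ex_bij_betw_finite_nat[OF fin(1)] card by (auto simp: atLeast0LessThan)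
  obtain g where g: "bij_betw g Q {..<n}"
    using ex_bij_betw_finite_nat[OF fin(2)] card by (auto simp: atLeast0LessThan)
  have f_less: "f x < m" if "x \<in> P" for x
    using f that by (auto simp: bij_betw_def)
  have g_less: "g y < n" if "y \<in> Q" for y
    using g that by (auto simp: bij_betw_def)
  have mono: "mono r" "mono c" and ends: "r 0 = 0" "c 0 = 0" "r L = m" "c L = n"
    using st by (auto simp: staircase_def)
  define R where "R i = {x \<in> P. f x < r i}" for i
  define C where "C i = {y \<in> Q. g y < c i}" for i
  have cardR: "card (R i) = r i" and cardC: "card (C i) = c i" if "i \<le> L" for i
    using staircase_le[OF st that]
    by (simp_all add: R_def C_def card_initial_labels[OF f] card_initial_labels[OF g])
  define B where "B i = P \<times> Q - R i \<times> C i - (P - R (Suc i)) \<times> (Q - C (Suc i))" for i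
  have R_mono: "R i \<subseteq> R j" and C_mono: "C i \<subseteq> C j" if "i \<le> j" for i j
    using monoD[OF mono(1) that] monoD[OF mono(2) that] by (auto simp: R_def C_def)
  have B_shared: "\<exists>i<L. (x, y) \<in> B i \<and> (x', y') \<in> B i"
    if v: "x \<in> P" "y \<in> Q" "x' \<in> P" "y' \<in> Q" and le: "f x \<le> f x'" "g y \<le> g y'"
      and adj: "x = x' \<or> y = y'" for x y x' y'
  proof -
    let ?in = "\<lambda>i. (x, y) \<in> R i \<times> C i"
    define j where "j = (LEAST j. ?in j)"
    have "?in L"
      using v by (simp add: R_def C_def ends f_less g_less)
    then have j: "?in j" "j \<le> L"
      unfolding j_def by (rule LeastI, rule Least_le)
    obtain i where i: "j = Suc i"
      using j(1) by (cases j) (auto simp: R_def ends)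
    have "\<not> ?in i"
      using not_less_Least[of i ?in] i by (simp add: j_def)
    then have "(x, y) \<in> B i" "(x', y') \<in> B i"
      using j v le adj i by (auto simp: B_def R_def C_def)
    moreover have "i < L"
      using i j by simp
    ultimately show ?thesis
      by blast
  qed
  have cardB: "int (card (B i)) = step_cost m n r c i" if "i < L" for i
  proof -
    let ?past = "R i \<times> C i" and ?future = "(P - R (Suc i)) \<times> (Q - C (Suc i))"
    have sub: "R j \<subseteq> P" "C j \<subseteq> Q" for j
      by (auto simp: R_def C_def)
    have finRC: "finite (R j)" "finite (C j)" for j
      using finite_subset[OF sub(1)] finite_subset[OF sub(2)] fin by auto
    have "?past \<inter> ?future = {}"
      using R_mono[of i "Suc i"] by auto
    then have "card (?past \<union> ?future) = card ?past + card ?future"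
      using fin finRC by (intro card_Un_disjoint) auto
    moreover have inside: "?past \<union> ?future \<subseteq> P \<times> Q"
      using sub by blast
    moreover have "card (?past \<union> ?future) \<le> card (P \<times> Q)"
      using inside fin by (intro card_mono) auto
    moreover have "card (P \<times> Q - (?past \<union> ?future)) = card (P \<times> Q) - card (?past \<union> ?future)"
      using inside fin finRC by (intro card_Diff_subset) auto
    moreover have "card (B i) = card (P \<times> Q - (?past \<union> ?future))"
      by (rule arg_cong[of _ _ card]) (auto simp: B_def)
    ultimately have "int (card (B i)) = int (card (P \<times> Q)) - int (card ?past) - int (card ?future)"
      by linarith
    then have "int (card (B i)) = int (card P * card Q) - int (card (R i) * card (C i))
        - int ((card P - card (R (Suc i))) * (card Q - card (C (Suc i))))"
      using sub finRC by (simp add: card_cartesian_product card_Diff_subset)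
    moreover have "r (Suc i) \<le> m" "c (Suc i) \<le> n"
      using staircase_le[OF st, of "Suc i"] that by auto
    ultimately show ?thesis
      using that by (simp add: step_cost_def card cardR cardC of_nat_diff)
  qed
  have "0 < L"
    using ends \<open>0 < m\<close> by (cases L) auto
  have "path_decomposition (with_proj (G \<box> H)) (map B [0..<L])"
    unfolding path_decomposition_def
  proof (intro conjI allI impI)
    show "map B [0..<L] \<noteq> []"
      using \<open>0 < L\<close> by simp
  next
    have "P \<times> Q \<subseteq> (\<Union>i<L. B i)"
      using B_shared by fastforce
    then show "(\<Union>i<length (map B [0..<L]). map B [0..<L] ! i) = verts (with_proj (G \<box> H))"
      unfolding verts_box P_def[symmetric] Q_def[symmetric] by (auto simp: B_def)
  next
    fix v w assume "v \<rightarrow>\<^bsub>with_proj (G \<box> H)\<^esub> w"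
    then obtain x y x' y' where v: "v = (x, y)" "w = (x', y')"
      "x \<in> P" "y \<in> Q" "x' \<in> P" "y' \<in> Q" "x = x' \<or> y = y'"
      unfolding dominates_box_complete[OF G H] P_def Q_def by (cases v; cases w) auto
    consider "f x \<le> f x'" "g y \<le> g y'" | "f x' \<le> f x" "g y' \<le> g y"
      using v(7) by (metis linear order_refl)
    then have "\<exists>i<L. v \<in> B i \<and> w \<in> B i"
    proof cases
      case 1
      then show ?thesis
        using B_shared[of x y x' y'] v by blast
    next
      case 2
      then show ?thesis
        using B_shared[of x' y' x y] v by blast
    qed
    then show "\<exists>i<length (map B [0..<L]). v \<in> map B [0..<L] ! i \<and> w \<in> map B [0..<L] ! i"
      by auto
  next
    fix i j k assume ijk: "i \<le> j \<and> j \<le> k \<and> k < length (map B [0..<L])"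
    have "R j \<subseteq> R k" "C j \<subseteq> C k" "R (Suc i) \<subseteq> R (Suc j)" "C (Suc i) \<subseteq> C (Suc j)"
      using ijk by (auto intro!: R_mono C_mono del: subsetI)
    then have "B i \<inter> B k \<subseteq> B j"
      unfolding B_def by blast
    then show "map B [0..<L] ! i \<inter> map B [0..<L] ! k \<subseteq> map B [0..<L] ! j"
      using ijk by simp
  qed
  then show ?thesis
    using cardB by (intro exI[of _ "map B [0..<L]"]) auto
qed

section \<open>The pathwidth\<close>

lemma pathwidth_box_complete:
  fixes G :: "('a, 'c) pre_digraph" and H :: "('b, 'd) pre_digraph"
  assumes "0 < m" "m \<le> n" and G: "K\<^bsub>m\<^esub> G" and H: "K\<^bsub>n\<^esub> H"
  shows "pathwidth (with_proj (G \<box> H)) =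
    int ((m - m div 2) * n + (if even m then m div 2 else 0)) - 1"
    (is "_ = int ?T - 1")
proof (rule antisym)
  interpret pair_graph "G \<box> H"
    using G H by (intro pair_graph_cartesian_product) (auto simp: complete_digraph_def)
  have wf: "wf_digraph (with_proj (G \<box> H))"
    by unfold_locales
  show "pathwidth (with_proj (G \<box> H)) \<le> int ?T - 1"
  proof -
    obtain L r c where st: "staircase m n L r c"
      and cheap: "\<And>i. i < L \<Longrightarrow> step_cost m n r c i \<le> int ?T"
      using cheap_staircase[OF \<open>m \<le> n\<close> refl refl] by blast
    obtain Bs where Bs: "path_decomposition (with_proj (G \<box> H)) Bs" "length Bs = L"
      "\<And>i. i < L \<Longrightarrow> int (card (Bs ! i)) = step_cost m n r c i"
      using path_decomposition_of_staircase[OF G H \<open>0 < m\<close> st] by blast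
    have "decomposition_width Bs \<le> int ?T - 1"
      using Bs cheap by (intro decomposition_width_leI) (auto simp: path_decomposition_def)
    then show ?thesis
      using pathwidth_le[OF wf Bs(1)] by linarith
  qed
  show "int ?T - 1 \<le> pathwidth (with_proj (G \<box> H))"
  proof -
    obtain Bs where Bs: "path_decomposition (with_proj (G \<box> H)) Bs"
      "decomposition_width Bs = pathwidth (with_proj (G \<box> H))"
      using pathwidth_attained[OF wf] by blast
    obtain r c where st: "staircase m n (length Bs) r c"
      and le: "\<And>i. i < length Bs \<Longrightarrow> step_cost m n r c i \<le> int (card (Bs ! i))"
      using staircase_of_path_decomposition[OF G H _ _ Bs(1)] assms by fastforce
    have "\<exists>i<length Bs. int ?T \<le> step_cost m n r c i"
    proof (cases "even m")
      case True
      then obtain k where "m = 2 * k" ..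
      then show ?thesis
        using even_staircase_costly_step[OF st, of k] assms by simp
    next
      case False
      then obtain k where "m = 2 * k + 1" ..
      then show ?thesis
        using odd_staircase_costly_step[OF st, of k] by simp
    qed
    then obtain i where "i < length Bs" "int ?T \<le> int (card (Bs ! i))"
      using le by fastforce
    then show ?thesis
      using card_bag_le_decomposition_width[of i Bs] Bs(2) by linarith
  qed
qed

theorem corollary15:
  fixes m n :: nat
    and G :: "('a, 'c) pre_digraph"
    and H :: "('b, 'd) pre_digraph"
  assumes "2 \<le> m" and "m \<le> n"
    and "K\<^bsub>m\<^esub> G" and "K\<^bsub>n\<^esub> H"
  shows "real_of_int (pathwidth (with_proj (G \<box> H))) =
    (if even m then real m / 2 * real n + real m / 2 - 1
     else real_of_int \<lceil>real m / 2\<rceil> * real n - 1)"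
proof (cases "even m")
  case True
  then obtain k where "m = 2 * k" ..
  then show ?thesis
    using pathwidth_box_complete[of m n G H] assms by simp
next
  case False
  then obtain k where k: "m = 2 * k + 1" ..
  have "\<lceil>real m / 2\<rceil> = int k + 1"
    by (rule ceiling_unique) (auto simp: k)
  then show ?thesis
    using pathwidth_box_complete[of m n G H] assms by (simp add: k distrib_right)
qed

end
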